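(* Suppose that the penalty $J$ satisfies $$J(uv)\le J(u)+J(v),\qquad J(u)=J\left(\frac1u\right),\qquad J(1)=0\qquad\text{for any }u,v\in\operatorname{dom}J,$$ that $H(f^\delta,f)\le\delta^2$ with $\delta>0$, and that the iterates $x_k$ of the multiplicative multiscale hierarchical decomposition method (MHDM) for the data $f^\delta$ are well-defined. Let $\tau>1$ and define the stopping index $$k^*(\delta):=\max\{k\in\mathbb{N}:\ H(f^\delta,Tx_k)\ge\tau\delta^2\}.$$ Then the stopping index $k^*(\delta)$ is finite. If $(k^*(\delta))$ is unbounded as $\delta\to0$, then $$\lim_{\delta\to0}H(f^\delta,Tx_{k^*(\delta)})=0$$ holds.
   Context: $\Omega\subseteq\mathbb{R}^2$ is a domain, $T:L^2(\Omega)\to L^2(\Omega)$ is a bounded linear operator, $f\in L^2(\Omega)$ is the exact data, $f^\delta$ is the noisy data for noise level $\delta>0$, and $z$ is a clean image satisfying $Tz=f$ and $J(z)<\infty$, where $J:L^2(\Omega)\to[0,\infty]$ is a proper function (the penalty) and $\operatorname{dom}J=\{u\in L^2(\Omega):J(u)<\infty\}$. The assumed properties of $J$ are understood to include that $uv$ and $1/u$ make sense and belong to $\operatorname{dom}J$ for $u,v\in\operatorname{dom}J$. $H$ is a non-negative data fitting term. The quantities $f,z,T,J,H,\lambda_0,\tau$ do not depend on $\delta$. Multiplicative MHDM (for given $f^\delta$): let $\lambda_0>0$ and $\lambda_{k+1}=2\lambda_k$ for $k\ge0$; set $x_{-1}=1$ and, for $k\ge0$, $x_k=\prod_{j=0}^{k}u_j$,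 where $$u_k\in\arg\min_uE_k(u),\qquad E_k(u)=\lambda_kH(f^\delta,T(ux_{k-1}))+J(u).$$ "The iterates are well-defined" means that for every $k\ge0$ such a minimizer $u_k$ exists (not necessarily unique; some choice is fixed) and all expressions $Tx_k$, $H(f^\delta,Tx_k)$ make sense. The minimization is over all $u\in L^2(\Omega)$ for which $E_k(u)$ makes sense. The finiteness of $k^*(\delta)$ means that the set of indices defining it is bounded above.
   Formalization: "Unbounded as δ→0" is strengthened to k*(δ)→∞ for the full limit; if k*(δ) is merely unbounded, the limit is claimed only along those δ→0 with k*(δ)→∞, since the literal claim fails when k* stays bounded along other δ→0. *)

theory Defs
  imports "HOL-Analysis.Analysis"
begin

text \<open>
  Elements of \<open>L\<^sup>2(\<Omega>)\<close> are represented by square-integrable functions; all maps on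
  \<open>L\<^sup>2(\<Omega>)\<close> are required to respect equality almost everywhere.  Values outside
  \<open>\<Omega>\<close> are irrelevant.
\<close>

type_synonym image = "real^2 \<Rightarrow> real"

definition L2 :: "(real^2) set \<Rightarrow> image set" where
  "L2 \<Omega> = {u \<in> borel_measurable (lebesgue_on \<Omega>). integrable (lebesgue_on \<Omega>) (\<lambda>t. (u t)\<^sup>2)}"

definition norm_L2 :: "(real^2) set \<Rightarrow> image \<Rightarrow> real" where
  "norm_L2 \<Omega> u = sqrt (\<integral>t. (u t)\<^sup>2 \<partial>lebesgue_on \<Omega>)"

definition ae_eq :: "(real^2) set \<Rightarrow> image \<Rightarrow> image \<Rightarrow> bool" where
  "ae_eq \<Omega> u v \<longleftrightarrow> (AE t in lebesgue_on \<Omega>. u t = v t)"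

definition bounded_linear_L2 :: "(real^2) set \<Rightarrow> (image \<Rightarrow> image) \<Rightarrow> bool" where
  "bounded_linear_L2 \<Omega> T \<longleftrightarrow>
     T \<in> L2 \<Omega> \<rightarrow> L2 \<Omega> \<and>
     (\<forall>u\<in>L2 \<Omega>. \<forall>v\<in>L2 \<Omega>. ae_eq \<Omega> u v \<longrightarrow> ae_eq \<Omega> (T u) (T v)) \<and>
     (\<forall>u\<in>L2 \<Omega>. \<forall>v\<in>L2 \<Omega>. ae_eq \<Omega> (T (\<lambda>t. u t + v t)) (\<lambda>t. T u t + T v t)) \<and>
     (\<forall>u\<in>L2 \<Omega>. \<forall>c. ae_eq \<Omega> (T (\<lambda>t. c * u t)) (\<lambda>t. c * T u t)) \<and>
     (\<exists>C. \<forall>u\<in>L2 \<Omega>. norm_L2 \<Omega> (T u) \<le> C * norm_L2 \<Omega> u)"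

definition eff_dom :: "(real^2) set \<Rightarrow> (image \<Rightarrow> ennreal) \<Rightarrow> image set" where
  "eff_dom \<Omega> J = {u \<in> L2 \<Omega>. J u < \<infinity>}"

definition proper_L2 :: "(real^2) set \<Rightarrow> (image \<Rightarrow> ennreal) \<Rightarrow> bool" where
  "proper_L2 \<Omega> J \<longleftrightarrow>
     (\<forall>u\<in>L2 \<Omega>. \<forall>v\<in>L2 \<Omega>. ae_eq \<Omega> u v \<longrightarrow> J u = J v) \<and> eff_dom \<Omega> J \<noteq> {}"

text \<open>
  As \<open>1 / 0 = 0\<close> in HOL, that \<open>1 / u\<close> makes sense has to be said separately.
  The condition on the constant \<open>1\<close> forces \<open>\<Omega>\<close> to have finite measure.
\<close>

definition multiplicative_penalty :: "(real^2) set \<Rightarrow> (image \<Rightarrow> ennreal) \<Rightarrow> bool" where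
  "multiplicative_penalty \<Omega> J \<longleftrightarrow>
     (\<forall>u\<in>eff_dom \<Omega> J. \<forall>v\<in>eff_dom \<Omega> J.
        (\<lambda>t. u t * v t) \<in> eff_dom \<Omega> J \<and> J (\<lambda>t. u t * v t) \<le> J u + J v) \<and>
     (\<forall>u\<in>eff_dom \<Omega> J.
        (AE t in lebesgue_on \<Omega>. u t \<noteq> 0) \<and>
        (\<lambda>t. 1 / u t) \<in> eff_dom \<Omega> J \<and> J u = J (\<lambda>t. 1 / u t)) \<and>
     (\<lambda>t. 1) \<in> eff_dom \<Omega> J \<and> J (\<lambda>t. 1) = 0"

text \<open>
  A data fitting term may be undefined for some arguments (think of logarithms or quotients
  of images), so it comes with the set \<open>D\<close> of pairs at which it is defined.
  The data argument is a mere parameter, not assumed to lie in \<open>L\<^sup>2(\<Omega>)\<close>.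
\<close>

definition data_fitting ::
  "(real^2) set \<Rightarrow> (image \<times> image) set \<Rightarrow> (image \<Rightarrow> image \<Rightarrow> ennreal) \<Rightarrow> bool" where
  "data_fitting \<Omega> D H \<longleftrightarrow>
     (\<forall>g. \<forall>v\<in>L2 \<Omega>. \<forall>w\<in>L2 \<Omega>. ae_eq \<Omega> v w \<longrightarrow>
        ((g, v) \<in> D \<longleftrightarrow> (g, w) \<in> D) \<and> ((g, v) \<in> D \<longrightarrow> H g v = H g w))"

definition iterate :: "(nat \<Rightarrow> image) \<Rightarrow> nat \<Rightarrow> image" where
  "iterate u k = (\<lambda>t. \<Prod>j\<le>k. u j t)"

text \<open>\<open>prev_iterate u k\<close> is \<open>x\<^bsub>k-1\<^esub>\<close>; the empty product gives \<open>x\<^bsub>-1\<^esub> = 1\<close>.\<close>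

definition prev_iterate :: "(nat \<Rightarrow> image) \<Rightarrow> nat \<Rightarrow> image" where
  "prev_iterate u k = (\<lambda>t. \<Prod>j<k. u j t)"

definition energy ::
  "(image \<Rightarrow> image) \<Rightarrow> (image \<Rightarrow> ennreal) \<Rightarrow> (image \<Rightarrow> image \<Rightarrow> ennreal) \<Rightarrow>
   real \<Rightarrow> image \<Rightarrow> image \<Rightarrow> image \<Rightarrow> ennreal" where
  "energy T J H l g x u = ennreal l * H g (T (\<lambda>t. u t * x t)) + J u"

text \<open>The images \<open>u\<close> at which \<open>energy T J H l g x u\<close> makes sense, \<open>x\<close> being the previous iterate.\<close>

definition admissible ::
  "(real^2) set \<Rightarrow> (image \<Rightarrow> image) \<Rightarrow> (image \<times> image) set \<Rightarrow> image \<Rightarrow> image \<Rightarrow> image \<Rightarrow> bool" where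
  "admissible \<Omega> T D g x u \<longleftrightarrow>
     u \<in> L2 \<Omega> \<and> (\<lambda>t. u t * x t) \<in> L2 \<Omega> \<and> (g, T (\<lambda>t. u t * x t)) \<in> D"

text \<open>
  \<open>u\<close> is a choice of minimizers.  Admissibility of \<open>u k\<close> contains that \<open>T x\<^sub>k\<close> and
  \<open>H g (T x\<^sub>k)\<close> make sense.
\<close>

definition mhdm ::
  "(real^2) set \<Rightarrow> (image \<Rightarrow> image) \<Rightarrow> (image \<Rightarrow> ennreal) \<Rightarrow> (image \<times> image) set \<Rightarrow>
   (image \<Rightarrow> image \<Rightarrow> ennreal) \<Rightarrow> (nat \<Rightarrow> real) \<Rightarrow> image \<Rightarrow> (nat \<Rightarrow> image) \<Rightarrow> bool" where
  "mhdm \<Omega> T J D H l g u \<longleftrightarrow>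
     (\<forall>k. is_arg_min (energy T J H (l k) g (prev_iterate u k))
                     (admissible \<Omega> T D g (prev_iterate u k)) (u k))"

text \<open>
  The maximum of an empty stopping set is some fixed, unspecified number; this affects neither
  unboundedness of the stopping index nor the limits taken along large stopping indices.
\<close>

definition stopping_set ::
  "(image \<Rightarrow> image) \<Rightarrow> (image \<Rightarrow> image \<Rightarrow> ennreal) \<Rightarrow> real \<Rightarrow> real \<Rightarrow> image \<Rightarrow> (nat \<Rightarrow> image) \<Rightarrow> nat set" where
  "stopping_set T H \<tau> \<delta> g u = {k. H g (T (iterate u k)) \<ge> ennreal (\<tau> * \<delta>\<^sup>2)}"

definition stopping_index ::
  "(image \<Rightarrow> image) \<Rightarrow> (image \<Rightarrow> image \<Rightarrow> ennreal) \<Rightarrow> real \<Rightarrow> real \<Rightarrow> image \<Rightarrow> (nat \<Rightarrow> image) \<Rightarrow> nat" where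
  "stopping_index T H \<tau> \<delta> g u = Max (stopping_set T H \<tau> \<delta> g u)"

definition unbounded_near_0 :: "(real \<Rightarrow> nat) \<Rightarrow> bool" where
  "unbounded_near_0 k \<longleftrightarrow> (\<forall>N. \<exists>\<^sub>F \<delta> in at_right 0. N \<le> k \<delta>)"

text \<open>
  The limit \<open>\<delta> \<rightarrow> 0\<close> through those \<open>\<delta>\<close> for which \<open>k \<delta> \<rightarrow> \<infinity>\<close>.  It is nontrivial exactly if
  \<open>k\<close> is unbounded near \<open>0\<close>, and it is the ordinary limit \<open>\<delta> \<rightarrow> 0\<close> if \<open>k \<delta> \<rightarrow> \<infinity>\<close>.
  Note that \<open>k\<close> need not be monotone in \<open>\<delta>\<close>: it may be unbounded near \<open>0\<close> while staying
  bounded along other sequences \<open>\<delta>\<^sub>n \<rightarrow> 0\<close>.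
\<close>

definition noise_limit :: "(real \<Rightarrow> nat) \<Rightarrow> real filter" where
  "noise_limit k = inf (at_right 0) (filtercomap k at_top)"

lemma noise_limit_neq_bot_iff: "noise_limit k \<noteq> bot \<longleftrightarrow> unbounded_near_0 k"
proof -
  have "noise_limit k = bot \<longleftrightarrow> (\<exists>N. \<forall>\<^sub>F \<delta> in at_right 0. \<not> N \<le> k \<delta>)"
  proof
    assume "noise_limit k = bot"
    then have "eventually (\<lambda>_. False) (inf (at_right 0) (filtercomap k at_top))"
      by (simp add: noise_limit_def)
    then obtain P Q where P: "eventually P (at_right (0::real))"
      and Q: "eventually Q (filtercomap k at_top)" and PQ: "\<And>x. P x \<Longrightarrow> Q x \<Longrightarrow> False"
      unfolding eventually_inf by auto
    from Q obtain N where N: "\<And>x. k x \<ge> N \<Longrightarrow> Q x"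
      unfolding eventually_filtercomap eventually_at_top_linorder by blast
    have "\<forall>\<^sub>F \<delta> in at_right 0. \<not> N \<le> k \<delta>"
      using P by (rule eventually_mono) (use N PQ in blast)
    then show "\<exists>N. \<forall>\<^sub>F \<delta> in at_right 0. \<not> N \<le> k \<delta>" by blast
  next
    assume "\<exists>N. \<forall>\<^sub>F \<delta> in at_right 0. \<not> N \<le> k \<delta>"
    then obtain N where N: "\<forall>\<^sub>F \<delta> in at_right 0. \<not> N \<le> k \<delta>" by blast
    have "eventually (\<lambda>\<delta>. N \<le> k \<delta>) (filtercomap k at_top)"
      by (intro eventually_filtercomapI eventually_ge_at_top)
    then have "eventually (\<lambda>_. False) (inf (at_right 0) (filtercomap k at_top))"
      unfolding eventually_inf using N by blast
    then show "noise_limit k = bot"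
      by (simp add: noise_limit_def trivial_limit_def)
  qed
  then show ?thesis
    by (simp add: unbounded_near_0_def frequently_def)
qed

lemma noise_limit_eq_at_right:
  assumes "filterlim k at_top (at_right 0)"
  shows "noise_limit k = at_right 0"
  using assms by (simp add: noise_limit_def inf_absorb1 filterlim_iff_le_filtercomap)

end

theory Submission
  imports Defs
begin

text \<open>
  Write \<open>h\<^sub>k\<close> for the residual of \<open>x\<^sub>k\<close>.  Comparing \<open>u\<^sub>k\<close> with the competitor \<open>1\<close> shows that
  \<open>h\<^sub>k\<close> is decreasing.  The competitor \<open>z / x\<^bsub>k-1\<^esub>\<close> gives
  \<open>l\<^sub>k h\<^sub>k + J u\<^sub>k \<le> l\<^sub>k \<delta>\<^sup>2 + J (z / x\<^bsub>k-1\<^esub>)\<close>, while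
  \<open>J (z / x\<^sub>k) \<le> J (z / x\<^bsub>k-1\<^esub>) + J u\<^sub>k\<close>.  As \<open>l\<^bsub>k+1\<^esub> = 2 l\<^sub>k\<close>, dividing by \<open>l\<^bsub>k+1\<^esub>\<close> makes
  the sum of these estimates telescope, so that \<open>h\<^sub>k \<le> \<delta>\<^sup>2 + 2 J z / (l\<^sub>0 (k + 1))\<close> for all \<open>k\<close>.
\<close>

lemma telescoping_residual_bound:
  fixes h w e l :: "nat \<Rightarrow> real" and d :: real
  assumes "l 0 > 0" "\<And>k. l (Suc k) = 2 * l k"
    and w: "\<And>k. w k \<ge> 0" "\<And>k. w (Suc k) \<le> w k + e k"
    and energy: "\<And>k. l k * h k + e k \<le> l k * d + w k"
    and h: "decseq h"
  shows "h k \<le> d + 2 * w 0 / (l 0 * real (Suc k))"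
proof -
  have l_pos: "l k > 0" for k
    by (induction k) (use assms(1,2) in auto)
  \<comment> \<open>The two estimates combine to
    \<open>h n - d \<le> (2 * w n - w (Suc n)) / l n\<close>. Since
    \<open>l (Suc n) = 2 * l n\<close>, the right side is the exact drop of the potential
    \<open>2 * w n / l n\<close>.\<close>
  have sum: "(\<Sum>j<n. h j - d) + 2 * w n / l n \<le> 2 * w 0 / l 0" for n
  proof (induction n)
    case (Suc n)
    have "w (Suc n) \<le> 2 * w n - l n * (h n - d)"
      using w(2)[of n] energy[of n] by (simp add: algebra_simps)
    then have "w (Suc n) / l n \<le> (2 * w n - l n * (h n - d)) / l n"
      using l_pos[of n] by (simp add: divide_right_mono)
    then have "2 * w (Suc n) / l (Suc n) \<le> 2 * w n / l n - (h n - d)"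
      using l_pos[of n] by (simp add: assms(2) diff_divide_distrib)
    with Suc show ?case by simp
  qed simp
  have "real (Suc k) * (h k - d) = (\<Sum>j<Suc k. h k - d)"
    by simp
  \<comment> \<open>Monotonicity makes the last residual at most the average of the first
    \<open>Suc k\<close> ones, whatever the signs of \<open>h j - d\<close>.\<close>
  also have "\<dots> \<le> (\<Sum>j<Suc k. h j - d)"
    by (intro sum_mono diff_right_mono decseqD[OF h]) auto
  also have "\<dots> \<le> 2 * w 0 / l 0"
    using sum[of "Suc k"] w(1)[of "Suc k"] l_pos[of "Suc k"]
    by (smt (verit) divide_nonneg_pos)
  finally have "h k - d \<le> 2 * w 0 / l 0 / real (Suc k)"
    by (subst pos_le_divide_eq) (simp_all only: mult.commute of_nat_0_less_iff zero_less_Suc)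
  then show ?thesis by simp
qed

lemma prev_iterate_0: "prev_iterate u 0 = (\<lambda>t. 1)"
  by (simp add: prev_iterate_def)

lemma prev_iterate_Suc: "prev_iterate u (Suc k) = (\<lambda>t. u k t * prev_iterate u k t)"
  by (simp add: prev_iterate_def mult.commute)

lemma iterate_eq_prev_iterate_Suc: "iterate u k = prev_iterate u (Suc k)"
  by (simp add: prev_iterate_def iterate_def lessThan_Suc_atMost)

lemma multiplicative_penaltyD:
  assumes "multiplicative_penalty \<Omega> J"
  shows "u \<in> eff_dom \<Omega> J \<Longrightarrow> v \<in> eff_dom \<Omega> J \<Longrightarrow> (\<lambda>t. u t * v t) \<in> eff_dom \<Omega> J"
    and "u \<in> eff_dom \<Omega> J \<Longrightarrow> v \<in> eff_dom \<Omega> J \<Longrightarrow> J (\<lambda>t. u t * v t) \<le> J u + J v"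
    and "u \<in> eff_dom \<Omega> J \<Longrightarrow> AE t in lebesgue_on \<Omega>. u t \<noteq> 0"
    and "u \<in> eff_dom \<Omega> J \<Longrightarrow> (\<lambda>t. 1 / u t) \<in> eff_dom \<Omega> J"
    and "u \<in> eff_dom \<Omega> J \<Longrightarrow> J (\<lambda>t. 1 / u t) = J u"
    and "(\<lambda>t. 1) \<in> eff_dom \<Omega> J" and "J (\<lambda>t. 1) = 0"
  using assms unfolding multiplicative_penalty_def
  by (blast, blast, blast, blast, metis, blast, blast)

text \<open>Division is multiplication by the reciprocal, which has the same penalty.\<close>

lemma multiplicative_penalty_divide:
  assumes "multiplicative_penalty \<Omega> J" "u \<in> eff_dom \<Omega> J" "v \<in> eff_dom \<Omega> J"
  shows "(\<lambda>t. u t / v t) \<in> eff_dom \<Omega> J" and "J (\<lambda>t. u t / v t) \<le> J u + J v"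
  using multiplicative_penaltyD(1,2)[OF assms(1,2) multiplicative_penaltyD(4)[OF assms(1,3)]]
    multiplicative_penaltyD(5)[OF assms(1,3)] by simp_all

lemma mhdm_admissible:
  "mhdm \<Omega> T J D H l g u \<Longrightarrow> admissible \<Omega> T D g (prev_iterate u k) (u k)"
  by (simp add: mhdm_def is_arg_min_linorder)

lemma mhdm_energy_le:
  assumes "mhdm \<Omega> T J D H l g u" "admissible \<Omega> T D g (prev_iterate u k) v"
  shows "ennreal (l k) * H g (T (iterate u k)) + J (u k)
    \<le> ennreal (l k) * H g (T (\<lambda>t. v t * prev_iterate u k t)) + J v"
  using assms unfolding mhdm_def is_arg_min_linorder energy_def
  by (simp add: iterate_eq_prev_iterate_Suc prev_iterate_Suc)

text \<open>The factor 1 leaves the previous iterate unchanged at zero penalty. The weight is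
  positive and finite, so it cancels even if residuals are infinite.\<close>

lemma mhdm_residual_Suc_le:
  assumes pen: "multiplicative_penalty \<Omega> J" and mhdm: "mhdm \<Omega> T J D H l g u"
    and pos: "l (Suc k) > 0"
  shows "H g (T (iterate u (Suc k))) \<le> H g (T (iterate u k))"
proof -
  let ?L = "ennreal (l (Suc k))"
  \<comment> \<open>The product with 1 is \<open>iterate u k\<close>, for which admissibility of
    \<open>u k\<close> already grants that the residual is defined.\<close>
  have "admissible \<Omega> T D g (prev_iterate u (Suc k)) (\<lambda>t. 1)"
    using mhdm_admissible[OF mhdm, of k] multiplicative_penaltyD(6)[OF pen]
    by (simp add: admissible_def prev_iterate_Suc eff_dom_def)
  from mhdm_energy_le[OF mhdm this]
  have "?L * H g (T (iterate u (Suc k))) + J (u (Suc k)) \<le> ?L * H g (T (iterate u k))"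
    by (simp add: multiplicative_penaltyD(7)[OF pen] iterate_eq_prev_iterate_Suc)
  then have "?L * H g (T (iterate u (Suc k))) \<le> ?L * H g (T (iterate u k))"
    by (rule order_trans[rotated]) simp
  then show ?thesis
    using pos by (simp add: ennreal_mult_le_mult_iff)
qed

lemma mhdm_energy_le_exact:
  assumes T: "bounded_linear_L2 \<Omega> T" and H: "data_fitting \<Omega> D H"
    and pen: "multiplicative_penalty \<Omega> J"
    and exact: "f \<in> L2 \<Omega>" "z \<in> eff_dom \<Omega> J" "ae_eq \<Omega> (T z) f"
    and D: "(g, f) \<in> D" and mhdm: "mhdm \<Omega> T J D H l g u"
    and x: "prev_iterate u k \<in> eff_dom \<Omega> J"
  shows "ennreal (l k) * H g (T (iterate u k)) + J (u k)
    \<le> ennreal (l k) * H g f + J (\<lambda>t. z t / prev_iterate u k t)"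
proof -
  let ?x = "prev_iterate u k"
  let ?v = "\<lambda>t. z t / ?x t"
  let ?vx = "\<lambda>t. ?v t * ?x t"
  have v: "?v \<in> eff_dom \<Omega> J"
    by (rule multiplicative_penalty_divide[OF pen exact(2) x])
  have L2: "?vx \<in> L2 \<Omega>" "z \<in> L2 \<Omega>" "?v \<in> L2 \<Omega>"
    using multiplicative_penaltyD(1)[OF pen v x] exact(2) v by (auto simp: eff_dom_def)
  \<comment> \<open>Cancellation fails where \<open>?x\<close> vanishes, which is only a null set;
    hence the passage through \<open>ae_eq\<close>, which \<open>T\<close> and then
    \<open>H g\<close> respect.\<close>
  have "ae_eq \<Omega> ?vx z"
    using multiplicative_penaltyD(3)[OF pen x] unfolding ae_eq_def by eventually_elim simp
  then have "ae_eq \<Omega> (T ?vx) (T z)"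
    using T L2 unfolding bounded_linear_L2_def by blast
  then have "ae_eq \<Omega> (T ?vx) f"
    using exact(3) unfolding ae_eq_def by eventually_elim simp
  moreover have TL2: "T ?vx \<in> L2 \<Omega>"
    using T L2 unfolding bounded_linear_L2_def by blast
  ultimately have *: "(g, T ?vx) \<in> D" "H g (T ?vx) = H g f"
    using H[unfolded data_fitting_def, rule_format, OF TL2 exact(1), of g] D by simp_all
  then have "admissible \<Omega> T D g ?x ?v"
    using L2 by (simp add: admissible_def)
  from mhdm_energy_le[OF mhdm this] * show ?thesis by simp
qed

text \<open>Admissibility does not bound the penalty. Finiteness of \<open>J (u k)\<close> comes
  from minimality against the quotient competitor, which in turn needs the previous iterate in the
  domain; so both claims advance in one induction.\<close>

lemma mhdm_prev_iterate_in_eff_dom: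
  assumes "bounded_linear_L2 \<Omega> T" "data_fitting \<Omega> D H" "multiplicative_penalty \<Omega> J"
    and "f \<in> L2 \<Omega>" "z \<in> eff_dom \<Omega> J" "ae_eq \<Omega> (T z) f"
    and "(g, f) \<in> D" and fin: "H g f < \<infinity>" and mhdm: "mhdm \<Omega> T J D H l g u"
  shows "prev_iterate u k \<in> eff_dom \<Omega> J" and "u k \<in> eff_dom \<Omega> J"
proof -
  have step: "u k \<in> eff_dom \<Omega> J" if x: "prev_iterate u k \<in> eff_dom \<Omega> J" for k
  proof -
    have "J (\<lambda>t. z t / prev_iterate u k t) < \<infinity>"
      using multiplicative_penalty_divide(1)[OF assms(3,5) x] by (simp add: eff_dom_def)
    then have "ennreal (l k) * H g f + J (\<lambda>t. z t / prev_iterate u k t) < \<infinity>"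
      using fin by (simp add: ennreal_mult_less_top)
    with mhdm_energy_le_exact[OF assms(1-7) mhdm x]
    have "J (u k) < \<infinity>"
      by (metis infinity_ennreal_def ennreal_add_eq_top top.not_eq_extremum le_less_trans)
    then show ?thesis
      using mhdm_admissible[OF mhdm, of k] by (simp add: eff_dom_def admissible_def)
  qed
  have "prev_iterate u k \<in> eff_dom \<Omega> J" for k
  proof (induction k)
    case 0
    then show ?case
      using multiplicative_penaltyD(6)[OF assms(3)] by (simp add: prev_iterate_0)
  next
    case (Suc k)
    show ?case
      unfolding prev_iterate_Suc
      by (rule multiplicative_penaltyD(1)[OF assms(3) step[OF Suc] Suc])
  qed
  with step show "prev_iterate u k \<in> eff_dom \<Omega> J" "u k \<in> eff_dom \<Omega> J" by blast+
qed

text \<open>The data \<open>g\<close> enter the bound only through \<open>d\<close>, so one constant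
  serves all noise levels.\<close>

theorem mhdm_residual_bound:
  assumes T: "bounded_linear_L2 \<Omega> T" and H: "data_fitting \<Omega> D H"
    and pen: "multiplicative_penalty \<Omega> J"
    and exact: "f \<in> L2 \<Omega>" "z \<in> eff_dom \<Omega> J" "ae_eq \<Omega> (T z) f"
    and l: "l 0 > 0" "\<And>k. l (Suc k) = 2 * l k"
    and g: "(g, f) \<in> D" "H g f \<le> ennreal d" "d \<ge> 0"
    and mhdm: "mhdm \<Omega> T J D H l g u"
  shows "H g (T (iterate u k)) \<le> ennreal (d + 2 * enn2real (J z) / (l 0 * real (Suc k)))"
proof -
  let ?H = "\<lambda>k. H g (T (iterate u k))" and ?W = "\<lambda>k. J (\<lambda>t. z t / prev_iterate u k t)"
  have l_pos: "l k > 0" for k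
    by (induction k) (use l in auto)
  have H_fin: "H g f < \<infinity>"
    using g(2) by (simp add: le_less_trans)
  note dom = mhdm_prev_iterate_in_eff_dom[OF T H pen exact g(1) H_fin mhdm]
  note W_dom = multiplicative_penalty_divide(1)[OF pen exact(2) dom(1)]
  have W_fin: "?W k < \<infinity>" and J_fin: "J (u k) < \<infinity>" for k
    using W_dom[of k] dom(2)[of k] by (auto simp: eff_dom_def)
  have E: "ennreal (l k) * ?H k + J (u k) \<le> ennreal (l k) * ennreal d + ?W k" for k
    by (rule order_trans[OF mhdm_energy_le_exact[OF T H pen exact g(1) mhdm dom(1)]])
      (intro add_right_mono mult_left_mono g(2), simp)
  \<comment> \<open>Positivity of \<open>l k\<close> is essential: a zero weight would hide an
    infinite residual.\<close>
  have h_fin: "?H k < \<infinity>" for k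
  proof -
    have "ennreal (l k) * ?H k + J (u k) < \<infinity>"
      by (rule le_less_trans[OF E]) (use W_fin[of k] in \<open>simp add: ennreal_mult_less_top\<close>)
    then show ?thesis
      using l_pos[of k] by (auto simp: ennreal_mult_less_top)
  qed
  \<comment> \<open>Telescoping subtracts, so it is done over the reals; finiteness makes the
    conversion lossless.\<close>
  define h e w where "h k = enn2real (?H k)" and "e k = enn2real (J (u k))"
    and "w k = enn2real (?W k)" for k
  have conv: "?H k = ennreal (h k)" "J (u k) = ennreal (e k)" "?W k = ennreal (w k)" for k
    using h_fin[of k] J_fin[of k] W_fin[of k] by (simp_all add: h_def e_def w_def)
  have nonneg: "h k \<ge> 0" "e k \<ge> 0" "w k \<ge> 0" for k
    by (simp_all add: h_def e_def w_def)
  have "h k \<le> d + 2 * w 0 / (l 0 * real (Suc k))"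
  proof (rule telescoping_residual_bound[where e = e])
    show "w (Suc k) \<le> w k + e k" for k
    proof -
      \<comment> \<open>The next quotient is the current one divided by \<open>u k\<close>.\<close>
      have "?W (Suc k) \<le> ?W k + J (u k)"
        using multiplicative_penalty_divide(2)[OF pen W_dom[of k] dom(2)[of k]]
        by (simp add: prev_iterate_Suc mult.commute)
      then show ?thesis
        using nonneg unfolding conv by (simp flip: ennreal_plus)
    qed
    show "l k * h k + e k \<le> l k * d + w k" for k
      using E[of k] l_pos[of k] nonneg g(3) unfolding conv
      by (simp add: less_imp_le flip: ennreal_mult ennreal_plus)
    show "decseq h"
      using mhdm_residual_Suc_le[OF pen mhdm l_pos] nonneg unfolding conv
      by (intro decseq_SucI) simp
  qed (use l nonneg in auto)
  \<comment> \<open>Here \<open>w 0\<close> is the real value of \<open>J z\<close>, because the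
    iterate before the first step is 1.\<close>
  then show ?thesis
    by (simp add: conv(1) w_def prev_iterate_0 ennreal_leI)
qed

theorem proposition4p5:
  fixes \<Omega> :: "(real^2) set"
    and T :: "image \<Rightarrow> image"
    and J :: "image \<Rightarrow> ennreal"
    and H :: "image \<Rightarrow> image \<Rightarrow> ennreal"
    and D :: "(image \<times> image) set"
    and f z :: image
    and f\<delta> :: "real \<Rightarrow> image"
    and l :: "nat \<Rightarrow> real"
    and u :: "real \<Rightarrow> nat \<Rightarrow> image"
    and \<tau> :: real
  defines "kstar \<equiv> \<lambda>\<delta>. stopping_index T H \<tau> \<delta> (f\<delta> \<delta>) (u \<delta>)"
  assumes domain: "open \<Omega>" "connected \<Omega>" "\<Omega> \<noteq> {}"
    and T: "bounded_linear_L2 \<Omega> T"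
    and H: "data_fitting \<Omega> D H"
    and J: "proper_L2 \<Omega> J" "multiplicative_penalty \<Omega> J"
    and exact: "f \<in> L2 \<Omega>" "z \<in> eff_dom \<Omega> J" "ae_eq \<Omega> (T z) f"
    and lambda: "l 0 > 0" "\<And>k. l (Suc k) = 2 * l k"
    and noise: "\<And>\<delta>. \<delta> > 0 \<Longrightarrow> (f\<delta> \<delta>, f) \<in> D \<and> H (f\<delta> \<delta>) f \<le> ennreal (\<delta>\<^sup>2)"
    and iterates: "\<And>\<delta>. \<delta> > 0 \<Longrightarrow> mhdm \<Omega> T J D H l (f\<delta> \<delta>) (u \<delta>)"
    and tau: "\<tau> > 1"
  shows "(\<forall>\<delta>>0. bdd_above (stopping_set T H \<tau> \<delta> (f\<delta> \<delta>) (u \<delta>))) \<and>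
         (filterlim kstar at_top (at_right 0) \<longrightarrow>
            ((\<lambda>\<delta>. H (f\<delta> \<delta>) (T (iterate (u \<delta>) (kstar \<delta>)))) \<longlongrightarrow> 0) (at_right 0)) \<and>
         (unbounded_near_0 kstar \<longrightarrow>
            ((\<lambda>\<delta>. H (f\<delta> \<delta>) (T (iterate (u \<delta>) (kstar \<delta>)))) \<longlongrightarrow> 0) (noise_limit kstar))"
proof -
  define c where "c = 2 * enn2real (J z) / l 0"
  have c: "c \<ge> 0"
    using lambda(1) by (simp add: c_def)
  have bound: "H (f\<delta> \<delta>) (T (iterate (u \<delta>) k)) \<le> ennreal (\<delta>\<^sup>2 + c / real (Suc k))"
    if "\<delta> > 0" for \<delta> k
    using mhdm_residual_bound[OF T H J(2) exact lambda _ _ zero_le_power2 iterates[OF that]]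
      noise[OF that] unfolding c_def divide_divide_eq_left by blast
  have finite: "bdd_above (stopping_set T H \<tau> \<delta> (f\<delta> \<delta>) (u \<delta>))" if \<delta>: "\<delta> > 0" for \<delta>
  proof (rule bdd_aboveI)
    fix k assume "k \<in> stopping_set T H \<tau> \<delta> (f\<delta> \<delta>) (u \<delta>)"
    then have "ennreal (\<tau> * \<delta>\<^sup>2) \<le> ennreal (\<delta>\<^sup>2 + c / real (Suc k))"
      unfolding stopping_set_def mem_Collect_eq by (rule order_trans[OF _ bound[OF \<delta>]])
    \<comment> \<open>As \<open>\<tau> > 1\<close>, the left side is a fixed positive number while
      the right side tends to 0 in \<open>k\<close>; this caps \<open>k\<close>.\<close>
    then have "(\<tau> - 1) * \<delta>\<^sup>2 \<le> c / real (Suc k)"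
      using c by (subst (asm) ennreal_le_iff) (simp_all add: algebra_simps)
    then have "real (Suc k) * ((\<tau> - 1) * \<delta>\<^sup>2) \<le> c"
      by (simp add: field_simps)
    then have "real (Suc k) \<le> c / ((\<tau> - 1) * \<delta>\<^sup>2)"
      using tau \<delta> by (subst pos_le_divide_eq) simp_all
    then have "real k \<le> real (nat \<lceil>c / ((\<tau> - 1) * \<delta>\<^sup>2)\<rceil>)"
      using real_nat_ceiling_ge[of "c / ((\<tau> - 1) * \<delta>\<^sup>2)"] by linarith
    then show "k \<le> nat \<lceil>c / ((\<tau> - 1) * \<delta>\<^sup>2)\<rceil>"
      by simp
  qed
  \<comment> \<open>Both limit claims follow from this one, as the filter is
    \<open>at_right 0\<close> when \<open>kstar\<close> diverges. Along it
    \<open>\<delta>\<^sup>2\<close> vanishes because it refines \<open>at_right 0\<close>, and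
    \<open>c / real (Suc (kstar \<delta>))\<close> because \<open>kstar\<close> tends to
    infinity.\<close>
  have lim: "((\<lambda>\<delta>. H (f\<delta> \<delta>) (T (iterate (u \<delta>) (kstar \<delta>)))) \<longlongrightarrow> 0) (noise_limit kstar)"
  proof (rule tendsto_sandwich[OF _ _ tendsto_const])
    have le: "noise_limit kstar \<le> at_right 0"
      by (simp add: noise_limit_def)
    have "filterlim kstar at_top (noise_limit kstar)"
      by (simp add: noise_limit_def filterlim_iff_le_filtercomap)
    then have "filterlim (\<lambda>\<delta>. Suc (kstar \<delta>)) at_top (noise_limit kstar)"
      by (rule filterlim_compose[OF filterlim_Suc])
    then have "filterlim (\<lambda>\<delta>. real (Suc (kstar \<delta>))) at_top (noise_limit kstar)"
      by (rule filterlim_compose[OF filterlim_real_sequentially])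
    then have "((\<lambda>\<delta>. c / real (Suc (kstar \<delta>))) \<longlongrightarrow> 0) (noise_limit kstar)"
      by (intro tendsto_divide_0[OF tendsto_const] filterlim_at_top_imp_at_infinity)
    moreover have "((\<lambda>\<delta>::real. \<delta>\<^sup>2) \<longlongrightarrow> 0\<^sup>2) (noise_limit kstar)"
      by (intro tendsto_power tendsto_mono[OF le] tendsto_ident_at)
    ultimately have "((\<lambda>\<delta>. \<delta>\<^sup>2 + c / real (Suc (kstar \<delta>))) \<longlongrightarrow> 0\<^sup>2 + 0) (noise_limit kstar)"
      by (intro tendsto_add)
    then have "((\<lambda>\<delta>. \<delta>\<^sup>2 + c / real (Suc (kstar \<delta>))) \<longlongrightarrow> 0) (noise_limit kstar)"
      by (simp only: power_zero_numeral add_0)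
    from tendsto_ennrealI[OF this] show "((\<lambda>\<delta>. ennreal (\<delta>\<^sup>2 + c / real (Suc (kstar \<delta>)))) \<longlongrightarrow> 0) (noise_limit kstar)"
      by (simp only: ennreal_0)
    \<comment> \<open>The bound holds at every index, so also at the unspecified value of
      \<open>Max\<close> on an empty stopping set.\<close>
    show "\<forall>\<^sub>F \<delta> in noise_limit kstar. H (f\<delta> \<delta>) (T (iterate (u \<delta>) (kstar \<delta>)))
        \<le> ennreal (\<delta>\<^sup>2 + c / real (Suc (kstar \<delta>)))"
      by (rule filter_leD[OF le])
        (rule eventually_mono[OF eventually_at_right_less bound])
  qed simp
  show ?thesis
  proof (intro conjI impI allI)
    assume "filterlim kstar at_top (at_right 0)"
    from lim[unfolded noise_limit_eq_at_right[OF this]]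
    show "((\<lambda>\<delta>. H (f\<delta> \<delta>) (T (iterate (u \<delta>) (kstar \<delta>)))) \<longlongrightarrow> 0) (at_right 0)" .
  qed (erule finite, rule lim)
qed

end
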